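(* Let $n,s,t, k_1, \ldots, k_t \in \mathbb{N}$. For each $i \in \{1,\ldots,t\}$, let $\mathbf{B}_i$ be a $k_i$-supernilpotent expanded elementary abelian group with $|\mathbf{B}_i| = p_i^{\alpha_i}$, where $p_i$ is a prime and $\alpha_i \in \mathbb{N}$ (all $\mathbf{B}_i$ of the same similarity type). Let $\mathbf{A} := \prod_{i=1}^t \mathbf{B}_i$, let $F \in \mathrm{Pol}_{n,s} (\mathbf{A})$, and let $\mathbf{a} \in A^n$. Then there is $\mathbf{y} \in A^n$ with $\operatorname{wt} (\mathbf{y}) \le \sum_{i = 1}^t k_i s \alpha_i (p_i-1)$ such that $F (\mathbf{a}) = F (\mathbf{y})$.
   Context: An expanded elementary abelian group is an algebra $(B;+,-,0,(f_j)_{j\in S})$ whose reduct $(B;+,-,0)$ is an elementary abelian group. The direct product $\mathbf{A}$ carries the componentwise operations; its zero $0$ is the tuple of zeros. $\mathrm{Pol}_n(\mathbf{A})$ is the set of $n$-ary polynomial functions of $\mathbf{A}$ (term functions of the expansion by all constants), and $\mathrm{Pol}_{n,s}(\mathbf{A})$ is the set of maps $A^n\to A^s$, $\mathbf{a}\mapsto(f_1(\mathbf{a}),\ldots,f_s(\mathbf{a}))$ with $f_1,\ldots,f_s\in\mathrm{Pol}_n(\mathbf{A})$. The weight of $\mathbf{y}\in A^n$ is $\operatorname{wt}(\mathbf{y}):=|\{j : \mathbf{y}(j)\neq 0\}|$. Higher commutators: for congruences $\alpha_1,\ldots,\alpha_r,\beta$ of an algebra ($r\ge 2$), $C(\alpha_1,\ldots,\alpha_r;\beta)$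 holds if for every term function $t$ and all tuples $\mathbf{a}_i\,\alpha_i\,\mathbf{b}_i$ (componentwise): if $t(\mathbf{x}_1,\ldots,\mathbf{x}_{r-1},\mathbf{a}_r)\,\beta\,t(\mathbf{x}_1,\ldots,\mathbf{x}_{r-1},\mathbf{b}_r)$ for all $(\mathbf{x}_1,\ldots,\mathbf{x}_{r-1})\in\prod_{i<r}\{\mathbf{a}_i,\mathbf{b}_i\}$ other than $(\mathbf{b}_1,\ldots,\mathbf{b}_{r-1})$, then $t(\mathbf{b}_1,\ldots,\mathbf{b}_{r-1},\mathbf{a}_r)\,\beta\,t(\mathbf{b}_1,\ldots,\mathbf{b}_{r-1},\mathbf{b}_r)$. $[\alpha_1,\ldots,\alpha_r]$ is the least such $\beta$. An algebra is $k$-supernilpotent if $[1,\ldots,1]$ ($k+1$ entries, $1$ the total congruence) is the identity congruence. *)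

theory Defs
  imports "HOL-Algebra.Group" "HOL-Library.NList" "HOL-Computational_Algebra.Primes"
begin

record 'f signature =
  syms :: "'f set"
  arity :: "'f \<Rightarrow> nat"

record ('f, 'a) algebra =
  universe :: "'a set"
  oper :: "'f \<Rightarrow> 'a list \<Rightarrow> 'a"

text \<open>Throughout, \<open>nlists n (universe A)\<close> is the set of \<open>n\<close>-tuples over the universe
  of \<open>A\<close>; tuple entries are numbered from 0.\<close>

definition is_algebra :: "'f signature \<Rightarrow> ('f, 'a) algebra \<Rightarrow> bool" where
  "is_algebra \<sigma> A \<longleftrightarrow>
     (\<forall>f\<in>syms \<sigma>. \<forall>xs\<in>nlists (arity \<sigma> f) (universe A). oper A f xs \<in> universe A)"

definition prod_algebra :: "'i set \<Rightarrow> ('i \<Rightarrow> ('f, 'a) algebra) \<Rightarrow> ('f, 'i \<Rightarrow> 'a) algebra" where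
  "prod_algebra I B =
     \<lparr>universe = PiE I (\<lambda>i. universe (B i)),
      oper = (\<lambda>f xs. \<lambda>i\<in>I. oper (B i) f (map (\<lambda>x. x i) xs))\<rparr>"


subsection \<open>Term functions and polynomial functions\<close>

datatype 'f uterm = Var nat | App 'f "'f uterm list"

inductive_set nary_terms :: "'f signature \<Rightarrow> nat \<Rightarrow> 'f uterm set" for \<sigma> n where
  Var: "i < n \<Longrightarrow> Var i \<in> nary_terms \<sigma> n"
| App: "f \<in> syms \<sigma> \<Longrightarrow> length us = arity \<sigma> f \<Longrightarrow> (\<And>u. u \<in> set us \<Longrightarrow> u \<in> nary_terms \<sigma> n)
        \<Longrightarrow> App f us \<in> nary_terms \<sigma> n"

primrec eval_term :: "('f, 'a) algebra \<Rightarrow> 'a list \<Rightarrow> 'f uterm \<Rightarrow> 'a" where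
  "eval_term A xs (Var i) = xs ! i"
| "eval_term A xs (App f us) = oper A f (map (eval_term A xs) us)"

definition term_functions :: "'f signature \<Rightarrow> ('f, 'a) algebra \<Rightarrow> nat \<Rightarrow> ('a list \<Rightarrow> 'a) set" where
  "term_functions \<sigma> A n =
     {\<lambda>xs\<in>nlists n (universe A). eval_term A xs u | u. u \<in> nary_terms \<sigma> n}"

definition const_signature :: "'f signature \<Rightarrow> ('f, 'a) algebra \<Rightarrow> ('f + 'a) signature" where
  "const_signature \<sigma> A =
     \<lparr>syms = syms \<sigma> <+> universe A, arity = case_sum (arity \<sigma>) (\<lambda>_. 0)\<rparr>"

definition const_expansion :: "('f, 'a) algebra \<Rightarrow> ('f + 'a, 'a) algebra" where
  "const_expansion A = \<lparr>universe = universe A, oper = case_sum (oper A) (\<lambda>c _. c)\<rparr>"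

definition Pol :: "'f signature \<Rightarrow> ('f, 'a) algebra \<Rightarrow> nat \<Rightarrow> ('a list \<Rightarrow> 'a) set" where
  "Pol \<sigma> A n = term_functions (const_signature \<sigma> A) (const_expansion A) n"

definition Pol_vec ::
    "'f signature \<Rightarrow> ('f, 'a) algebra \<Rightarrow> nat \<Rightarrow> nat \<Rightarrow> ('a list \<Rightarrow> 'a list) set" where
  "Pol_vec \<sigma> A n s =
     {\<lambda>xs\<in>nlists n (universe A). map (\<lambda>f. f xs) fs | fs. fs \<in> nlists s (Pol \<sigma> A n)}"


subsection \<open>Higher commutators and supernilpotency\<close>

definition congruence :: "'f signature \<Rightarrow> ('f, 'a) algebra \<Rightarrow> 'a rel \<Rightarrow> bool" where
  "congruence \<sigma> A \<theta> \<longleftrightarrow> equiv (universe A) \<theta> \<and>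
     (\<forall>f\<in>syms \<sigma>. \<forall>xs\<in>nlists (arity \<sigma> f) (universe A). \<forall>ys\<in>nlists (arity \<sigma> f) (universe A).
        list_all2 (\<lambda>x y. (x, y) \<in> \<theta>) xs ys \<longrightarrow> (oper A f xs, oper A f ys) \<in> \<theta>)"

text \<open>The concatenation of the \<open>m\<close> blocks \<open>x\<^sub>0, \<dots>, x\<^sub>m\<^sub>-\<^sub>1\<close>, where \<open>x\<^sub>i\<close> is \<open>b\<^sub>i\<close> for \<open>i \<in> I\<close>
  and \<open>a\<^sub>i\<close> otherwise.\<close>

definition mixed_args :: "nat \<Rightarrow> (nat \<Rightarrow> 'a list) \<Rightarrow> (nat \<Rightarrow> 'a list) \<Rightarrow> nat set \<Rightarrow> 'a list" where
  "mixed_args m a b I = concat (map (\<lambda>i. if i \<in> I then b i else a i) [0..<m])"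

text \<open>The condition \<open>C(\<alpha>\<^sub>0, \<dots>, \<alpha>\<^sub>m; \<beta>)\<close>, so \<open>r = m + 1\<close>. A choice from \<open>\<Prod>\<^sub>i {a\<^sub>i, b\<^sub>i}\<close> is
  encoded by the set \<open>I\<close> of positions at which \<open>b\<^sub>i\<close> is taken, and the excluded choice is
  \<open>I = {..<m}\<close>. This matters when \<open>a\<^sub>i = b\<^sub>i\<close> for some \<open>i\<close>: removing instead the tuple
  \<open>(b\<^sub>0, \<dots>, b\<^sub>m\<^sub>-\<^sub>1)\<close> from the set of tuples would leave no premises at all when \<open>a\<^sub>i = b\<^sub>i\<close>
  for all \<open>i < m\<close>, and would thereby force \<open>\<alpha>\<^sub>m \<subseteq> \<beta>\<close>.\<close>

definition centralizes ::
    "'f signature \<Rightarrow> ('f, 'a) algebra \<Rightarrow> 'a rel list \<Rightarrow> 'a rel \<Rightarrow> bool" where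
  "centralizes \<sigma> A \<alpha>s \<beta> \<longleftrightarrow> (let m = length \<alpha>s - 1 in
     \<forall>a b. (\<forall>i\<le>m. list_all2 (\<lambda>x y. (x, y) \<in> \<alpha>s ! i) (a i) (b i)) \<longrightarrow>
       (\<forall>t\<in>term_functions \<sigma> A (\<Sum>i\<le>m. length (a i)).
          (\<forall>I. I \<subset> {..<m} \<longrightarrow>
             (t (mixed_args m a b I @ a m), t (mixed_args m a b I @ b m)) \<in> \<beta>) \<longrightarrow>
          (t (mixed_args m a b {..<m} @ a m), t (mixed_args m a b {..<m} @ b m)) \<in> \<beta>))"

definition commutator :: "'f signature \<Rightarrow> ('f, 'a) algebra \<Rightarrow> 'a rel list \<Rightarrow> 'a rel" where
  "commutator \<sigma> A \<alpha>s = (LEAST \<beta>. congruence \<sigma> A \<beta> \<and> centralizes \<sigma> A \<alpha>s \<beta>)"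

definition supernilpotent :: "'f signature \<Rightarrow> nat \<Rightarrow> ('f, 'a) algebra \<Rightarrow> bool" where
  "supernilpotent \<sigma> k A \<longleftrightarrow>
     commutator \<sigma> A (replicate (k + 1) (universe A \<times> universe A)) = Id_on (universe A)"


subsection \<open>Expanded elementary abelian groups\<close>

definition elementary_abelian_group :: "('a, 'm) monoid_scheme \<Rightarrow> bool" where
  "elementary_abelian_group G \<longleftrightarrow> comm_group G \<and>
     (\<exists>p::nat. prime p \<and> (\<forall>x\<in>carrier G. x [^]\<^bsub>G\<^esub> p = \<one>\<^bsub>G\<^esub>))"

datatype 'j group_sym = Plus | Minus | Zero | Extra 'j

text \<open>The similarity type of \<open>(B; +, -, 0, (f\<^sub>j)\<^sub>j\<^sub>\<in>\<^sub>S)\<close>, where \<open>\<tau>\<close> is the type of the \<open>f\<^sub>j\<close>.\<close>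

definition group_signature :: "'j signature \<Rightarrow> 'j group_sym signature" where
  "group_signature \<tau> =
     \<lparr>syms = {Plus, Minus, Zero} \<union> Extra ` syms \<tau>,
      arity = case_group_sym 2 1 0 (arity \<tau>)\<rparr>"

definition zero_elem :: "('j group_sym, 'a) algebra \<Rightarrow> 'a" where
  "zero_elem A = oper A Zero []"

definition group_reduct :: "('j group_sym, 'a) algebra \<Rightarrow> 'a monoid" where
  "group_reduct A =
     \<lparr>carrier = universe A, monoid.mult = (\<lambda>x y. oper A Plus [x, y]), one = zero_elem A\<rparr>"

definition expanded_elementary_abelian_group ::
    "'j signature \<Rightarrow> ('j group_sym, 'a) algebra \<Rightarrow> bool" where
  "expanded_elementary_abelian_group \<tau> A \<longleftrightarrow>
     is_algebra (group_signature \<tau>) A \<and>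
     elementary_abelian_group (group_reduct A) \<and>
     (\<forall>x\<in>universe A. oper A Minus [x] = inv\<^bsub>group_reduct A\<^esub> x)"

definition weight :: "('j group_sym, 'a) algebra \<Rightarrow> 'a list \<Rightarrow> nat" where
  "weight A y = card {j. j < length y \<and> y ! j \<noteq> zero_elem A}"

end

theory Submission
  imports Defs "HOL-Number_Theory.Residues"
begin

text \<open>Polynomials of a direct product act componentwise, and the components of \<open>y\<close> may be chosen
  independently, so it suffices to find in each factor a small set \<open>I\<close> of positions such that
  setting the other entries of the tuple to zero does not change the given \<open>s\<close> values; the
  weights then add up. In one \<open>k\<close>-supernilpotent factor of order \<open>p\<^sup>\<alpha>\<close>, the value obtained by
  keeping the entries in \<open>I\<close> is, in each of the \<open>\<alpha>\<close> coordinates over the field with \<open>p\<close>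
  elements, a multilinear polynomial of degree at most \<open>k\<close> in the indicator variables of \<open>I\<close>:
  its coefficient at a set \<open>J\<close> is the value of an iterated difference term which is absorbing in
  all variables from \<open>J\<close>, and therefore vanishes for \<open>card J > k\<close>. A Chevalley--Warning argument
  for these \<open>s * \<alpha>\<close> polynomials gives a solution \<open>I\<close> of size at most
  \<open>k * s * \<alpha> * (p - 1)\<close>.\<close>

section \<open>Set functions of bounded degree\<close>

text \<open>The monomial of \<open>J\<close> is the product of the 0-1 indicator variables of its
  elements, so these are the multilinear integer polynomials of degree at most \<open>d\<close>.
  Generating them inductively reduces closure properties to monomials.\<close>

inductive degree_le :: "nat \<Rightarrow> ('c set \<Rightarrow> int) \<Rightarrow> bool" for d where
  monomial: "finite J \<Longrightarrow> card J \<le> d \<Longrightarrow> degree_le d (\<lambda>I. if J \<subseteq> I then c else 0)"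
| add: "degree_le d f \<Longrightarrow> degree_le d g \<Longrightarrow> degree_le d (\<lambda>I. f I + g I)"

lemma degree_le_const: "degree_le d (\<lambda>I. c)"
  using monomial[of "{}" d c] by simp

lemma degree_le_sum:
  assumes "\<And>x. x \<in> X \<Longrightarrow> degree_le d (f x)"
  shows "degree_le d (\<lambda>I. \<Sum>x\<in>X. f x I)"
proof (cases "finite X")
  case True
  then show ?thesis using assms
    by (induction X) (auto intro: degree_le_const degree_le.add)
qed (simp add: degree_le_const)

text \<open>Indicator variables are idempotent, so the monomials of \<open>J\<close> and
  \<open>K\<close> multiply to that of \<open>J \<union> K\<close>, whose size is at most the sum of
  the two sizes.\<close>

lemma degree_le_mult:
  assumes "degree_le d f" "degree_le e g"
  shows "degree_le (d + e) (\<lambda>I. f I * g I)"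
  using assms(1)
proof induction
  case (monomial J c)
  show ?case using assms(2)
  proof induction
    case (monomial K c')
    have "(\<lambda>I. (if J \<subseteq> I then c else 0) * (if K \<subseteq> I then c' else 0)) =
        (\<lambda>I. if J \<union> K \<subseteq> I then c * c' else 0)" by auto
    moreover have "card (J \<union> K) \<le> d + e"
      using card_Un_le[of J K] monomial \<open>card J \<le> d\<close> by linarith
    ultimately show ?case
      using degree_le.monomial[of "J \<union> K" "d + e" "c * c'"] monomial \<open>finite J\<close> by simp
  next
    case (add g g')
    then show ?case
      using degree_le.add[OF add.IH] by (simp add: distrib_left)
  qed
next
  case (add f f')
  then show ?case
    using degree_le.add[OF add.IH] by (simp add: distrib_right)
qed

lemma degree_le_power: "degree_le d f \<Longrightarrow> degree_le (d * m) (\<lambda>I. f I ^ m)"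
proof (induction m)
  case (Suc m)
  then show ?case using degree_le_mult[OF \<open>degree_le d f\<close> Suc.IH] by simp
qed (simp add: degree_le_const)

lemma degree_le_prod:
  assumes "finite X" "\<And>x. x \<in> X \<Longrightarrow> degree_le d (f x)"
  shows "degree_le (d * card X) (\<lambda>I. \<Prod>x\<in>X. f x I)"
  using assms
proof (induction X)
  case (insert x X)
  then show ?case using degree_le_mult[of d "f x" "d * card X"] by simp
qed (simp add: degree_le_const)

section \<open>Alternating sums over the subsets of a finite set\<close>

lemma sum_Pow_insert:
  fixes f :: "'c set \<Rightarrow> int"
  assumes "finite N" "x \<notin> N"
  shows "(\<Sum>I\<in>Pow (insert x N). f I) = (\<Sum>I\<in>Pow N. f I + f (insert x I))"
proof -
  have "inj_on (insert x) (Pow N)"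
    using assms(2) by (auto simp: inj_on_def)
  then have "(\<Sum>I\<in>insert x ` Pow N. f I) = (\<Sum>I\<in>Pow N. f (insert x I))"
    by (simp add: sum.reindex)
  moreover have "Pow N \<inter> insert x ` Pow N = {}" using assms(2) by auto
  ultimately show ?thesis
    using assms(1) by (simp add: Pow_insert sum.union_disjoint sum.distrib)
qed

text \<open>A monomial of degree below \<open>card N\<close> misses some \<open>x\<close> in
  \<open>N\<close>. Adding \<open>x\<close> to a set keeps the value and flips the sign, so the
  subsets of \<open>N\<close> cancel in pairs.\<close>

lemma alternating_sum_degree_le:
  assumes "degree_le d f" "finite N" "d < card N"
  shows "(\<Sum>I\<in>Pow N. (-1) ^ card I * f I) = 0"
  using assms(1)
proof induction
  case (monomial J c)
  have "\<not> N \<subseteq> J"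
    using card_mono[OF monomial(1), of N] monomial(2) assms(3) by linarith
  then obtain x where x: "x \<in> N" "x \<notin> J" by blast
  define N' where "N' = N - {x}"
  have N: "N = insert x N'" "finite N'" "x \<notin> N'"
    using x assms(2) by (auto simp: N'_def)
  have "(-1) ^ card I * (if J \<subseteq> I then c else 0)
      + (-1) ^ card (insert x I) * (if J \<subseteq> insert x I then c else 0) = 0" if "I \<subseteq> N'" for I
  proof -
    have "x \<notin> I" "finite I" using that N(2,3) by (auto intro: finite_subset)
    moreover have "J \<subseteq> insert x I \<longleftrightarrow> J \<subseteq> I" using x by auto
    ultimately show ?thesis by simp
  qed
  then show ?case
    unfolding N(1) sum_Pow_insert[OF N(2,3)] by (intro sum.neutral) simp
next
  case (add f g)
  then show ?case by (simp add: distrib_left sum.distrib)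
qed

text \<open>The coefficient of the monomial of \<open>J\<close> in the multilinear polynomial that
  represents \<open>f\<close>. Indexing by the removed elements \<open>K\<close> matches the signs
  produced later by zeroing variables.\<close>

definition moebius :: "('c set \<Rightarrow> int) \<Rightarrow> 'c set \<Rightarrow> int" where
  "moebius f J = (\<Sum>K\<in>Pow J. (-1) ^ card K * f (J - K))"

text \<open>The terms with \<open>x\<close> in \<open>K\<close> and those without it combine to a
  discrete derivative in direction \<open>x\<close>; this recursion drives the inversion
  formula.\<close>

lemma moebius_insert:
  assumes "finite J" "x \<notin> J"
  shows "moebius f (insert x J) = moebius (\<lambda>I. f (insert x I)) J - moebius f J"
proof -
  have "(-1) ^ card K * f (insert x J - K) + (-1) ^ card (insert x K) * f (insert x J - insert x K)
      = (-1) ^ card K * f (insert x (J - K)) - (-1) ^ card K * f (J - K)" if "K \<subseteq> J" for K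
  proof -
    have "x \<notin> K" "finite K" using that assms by (auto intro: finite_subset)
    moreover have "insert x J - insert x K = J - K" "insert x J - K = insert x (J - K)"
      using assms that by auto
    ultimately show ?thesis by simp
  qed
  then show ?thesis
    unfolding moebius_def sum_Pow_insert[OF assms] sum_subtractf[symmetric]
    by (intro sum.cong) auto
qed

lemma moebius_inversion: "finite I \<Longrightarrow> (\<Sum>J\<in>Pow I. moebius f J) = f I"
proof (induction I arbitrary: f rule: finite_induct)
  case empty
  then show ?case by (simp add: moebius_def)
next
  case (insert x I)
  have "(\<Sum>J\<in>Pow (insert x I). moebius f J)
      = (\<Sum>J\<in>Pow I. moebius (\<lambda>I. f (insert x I)) J)"
    unfolding sum_Pow_insert[OF insert(1,2)]
  proof (intro sum.cong refl)
    fix J assume "J \<in> Pow I"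
    then have "finite J" "x \<notin> J" using insert(1,2) finite_subset by auto
    then show "moebius f J + moebius f (insert x J) = moebius (\<lambda>I. f (insert x I)) J"
      by (simp add: moebius_insert)
  qed
  then show ?case using insert.IH by simp
qed

text \<open>In the inversion formula the terms with \<open>card J > d\<close> vanish modulo
  \<open>m\<close>, and what is left is a polynomial of degree at most \<open>d\<close>.\<close>

lemma degree_le_of_moebius:
  assumes "finite N" "\<And>J. J \<subseteq> N \<Longrightarrow> d < card J \<Longrightarrow> m dvd moebius f J"
  obtains g where "degree_le d g" "\<And>I. I \<subseteq> N \<Longrightarrow> [f I = g I] (mod m)"
proof
  let ?g = "\<lambda>I. \<Sum>J\<in>{J \<in> Pow N. card J \<le> d}. if J \<subseteq> I then moebius f J else 0"
  show "degree_le d ?g"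
    using assms(1) finite_subset by (intro degree_le_sum monomial) auto
  fix I assume I: "I \<subseteq> N"
  then have fin: "finite I" using assms(1) finite_subset by blast
  have "?g I = (\<Sum>J\<in>Pow I. if card J \<le> d then moebius f J else 0)"
    using I assms(1) by (intro sum.mono_neutral_cong) (auto intro: finite_subset)
  moreover have "[(\<Sum>J\<in>Pow I. moebius f J) = \<dots>] (mod m)"
    using I assms(2) by (intro cong_sum) (auto simp: cong_0_iff not_le)
  ultimately show "[f I = ?g I] (mod m)"
    by (simp add: moebius_inversion[OF fin])
qed

text \<open>The argument behind the Chevalley--Warning theorem: on the subsets of a minimal solution
  \<open>I\<close>, the product below is modulo \<open>p\<close> the indicator function of \<open>I\<close>, which has degree
  \<open>card I\<close>.\<close>

lemma small_solution:
  fixes f :: "'l \<Rightarrow> 'c set \<Rightarrow> int" and p :: nat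
  assumes p: "prime p" and fin: "finite L" "finite N"
    and deg: "\<And>l. l \<in> L \<Longrightarrow> degree_le d (f l)"
  obtains I where "I \<subseteq> N" "card I \<le> d * (p - 1) * card L"
    "\<And>l. l \<in> L \<Longrightarrow> [f l I = f l N] (mod int p)"
proof -
  define S where "S = {I. I \<subseteq> N \<and> (\<forall>l\<in>L. [f l I = f l N] (mod int p))}"
  have "N \<in> S" by (simp add: S_def)
  moreover have "finite S" using fin by (simp add: S_def)
  ultimately obtain I where I: "I \<in> S" and min: "\<And>J. J \<in> S \<Longrightarrow> J \<subseteq> I \<Longrightarrow> J = I"
    by (metis empty_iff finite_has_minimal)
  have finI: "finite I" using I fin finite_subset by (auto simp: S_def)
  have "card I \<le> d * (p - 1) * card L"
  proof (rule ccontr)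
    assume large: "\<not> ?thesis"
    \<comment> \<open>Modulo \<open>p\<close> a factor is 1 if \<open>J\<close> satisfies the
      equation of \<open>l\<close> and, by Fermat's little theorem, 0 if it does not. So
      \<open>g\<close> tests whether \<open>J\<close> is a solution, at a cost of degree
      \<open>d * (p - 1)\<close> per equation.\<close>
    define g where "g J = (\<Prod>l\<in>L. 1 - (f l J - f l N) ^ (p - 1))" for J
    have "degree_le d (\<lambda>J. f l J + - f l N)" if "l \<in> L" for l
      using degree_le.add[OF deg[OF that] degree_le_const] .
    from degree_le_power[OF this, of _ "p - 1"]
    have "degree_le (d * (p - 1)) (\<lambda>J. - 1 * (f l J - f l N) ^ (p - 1))" if "l \<in> L" for l
      using degree_le_mult[OF degree_le_const[of 0 "-1"]] that by fastforce
    from degree_le.add[OF degree_le_const[of _ 1] this]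
    have "degree_le (d * (p - 1) * card L) g"
      unfolding g_def by (intro degree_le_prod fin) simp
    with large have "(\<Sum>J\<in>Pow I. (-1) ^ card J * g J) = 0"
      by (intro alternating_sum_degree_le finI) auto
    \<comment> \<open>The sum is 0 by its degree, yet by minimality of \<open>I\<close> only the
      term \<open>J = I\<close> survives modulo \<open>p\<close>, which leaves plus or minus
      1.\<close>
    moreover have "[(\<Sum>J\<in>Pow I. (-1) ^ card J * g J)
        = (\<Sum>J\<in>Pow I. if J = I then (-1) ^ card I else 0)] (mod int p)"
    proof (rule cong_sum)
      fix J assume "J \<in> Pow I"
      show "[(-1) ^ card J * g J = (if J = I then (-1) ^ card I else 0)] (mod int p)"
      proof (cases "J = I")
        case True
        have "[g I = (\<Prod>l\<in>L. 1)] (mod int p)" unfolding g_def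
        proof (rule cong_prod)
          fix l assume "l \<in> L"
          then have "int p dvd f l I - f l N"
            using I by (simp add: S_def cong_iff_dvd_diff)
          moreover have "p - 1 > 0" using prime_gt_1_nat[OF p] by simp
          ultimately have "int p dvd (f l I - f l N) ^ (p - 1)"
            by (metis dvd_trans dvd_power)
          then show "[1 - (f l I - f l N) ^ (p - 1) = 1] (mod int p)"
            by (simp add: cong_iff_dvd_diff)
        qed
        then show ?thesis using True cong_scalar_left[of "g I" 1 "int p" "(-1) ^ card I"] by simp
      next
        case False
        then have "J \<notin> S" using min \<open>J \<in> Pow I\<close> by blast
        then obtain l where l: "l \<in> L" "\<not> int p dvd f l J - f l N"
          using \<open>J \<in> Pow I\<close> I by (auto simp: S_def cong_iff_dvd_diff)
        have "[(f l J - f l N) ^ (p - 1) = 1] (mod int p)"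
        proof -
          define b where "b = nat ((f l J - f l N) mod int p)"
          have b: "[int b = f l J - f l N] (mod int p)"
            using prime_gt_0_nat[OF p] by (simp add: b_def cong_def)
          then have "\<not> p dvd b" using l(2)
            by (metis cong_dvd_iff int_dvd_int_iff)
          from fermat_theorem[OF p this] have "[int b ^ (p - 1) = 1] (mod int p)"
            by (metis cong_int_iff of_nat_1 of_nat_power)
          then show ?thesis using cong_pow[OF b, of "p - 1"] cong_sym cong_trans by blast
        qed
        then have "int p dvd 1 - (f l J - f l N) ^ (p - 1)"
          by (metis cong_iff_dvd_diff cong_sym)
        then have "int p dvd g J" unfolding g_def
          using l(1) fin by (meson dvd_prodI dvd_trans)
        then show ?thesis using False by (simp add: cong_0_iff)
      qed
    qed
    ultimately have "int p dvd (-1) ^ card I"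
      using finI by (simp add: cong_0_iff cong_sym_eq[of 0])
    then have "int p dvd 1" by (metis dvd_minus_iff minus_one_power_iff)
    then show False using p by auto
  qed
  with I show ?thesis using that by (auto simp: S_def)
qed

section \<open>Coordinates of elementary abelian groups\<close>

text \<open>For prime \<open>q\<close>, the maps \<open>\<chi> l\<close> act as coordinates of
  \<open>H\<close> over the field with \<open>q\<close> elements: they are additive modulo
  \<open>q\<close> with trivial common kernel. Their values are integers, taken up to congruence, to
  fit the integer-valued set functions.\<close>

definition (in comm_group) coordinates :: "nat \<Rightarrow> 'a set \<Rightarrow> nat \<Rightarrow> (nat \<Rightarrow> 'a \<Rightarrow> int) \<Rightarrow> bool" where
  "coordinates q H r \<chi> \<longleftrightarrow> subgroup H G \<and> card H = q ^ r \<and>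
     (\<forall>l<r. \<forall>x\<in>H. \<forall>y\<in>H. [\<chi> l (x \<otimes> y) = \<chi> l x + \<chi> l y] (mod int q)) \<and>
     (\<forall>x\<in>H. (\<forall>l<r. int q dvd \<chi> l x) \<longrightarrow> x = \<one>)"

lemma (in group) pow_mod_exponent:
  assumes "x \<in> carrier G" "x [^] (q::nat) = \<one>"
  shows "x [^] (m mod q) = x [^] m"
proof -
  have "x [^] m = x [^] (q * (m div q) + m mod q)" by simp
  also have "\<dots> = x [^] (q * (m div q)) \<otimes> x [^] (m mod q)"
    using assms(1) by (simp add: nat_pow_mult)
  also have "\<dots> = x [^] (m mod q)"
    using assms by (simp flip: nat_pow_pow)
  finally show ?thesis by simp
qed

lemma (in group) subgroup_nat_pow:
  assumes "subgroup H G" "x \<in> H"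
  shows "x [^] (m::nat) \<in> H"
proof (induction m)
  case 0
  show ?case using subgroup.one_closed[OF assms(1)] by simp
next
  case (Suc m)
  show ?case using subgroup.m_closed[OF assms(1) Suc assms(2)] by simp
qed

text \<open>Each element of the subgroup generated by \<open>H\<close> and \<open>x\<close> is
  uniquely an element of \<open>H\<close> times a power of \<open>x\<close> with exponent below
  \<open>q\<close>; that exponent is the new coordinate.\<close>

lemma (in comm_group) coordinates_extend:
  assumes q: "prime q" and exponent: "\<And>x. x \<in> carrier G \<Longrightarrow> x [^] q = \<one>"
    and H: "coordinates q H r \<chi>" and x: "x \<in> carrier G" "x \<notin> H"
  shows "\<exists>H' \<chi>'. coordinates q H' (Suc r) \<chi>'"
proof -
  have subH: "subgroup H G" and cardH: "card H = q ^ r"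
    and hom: "\<And>l h h'. l < r \<Longrightarrow> h \<in> H \<Longrightarrow> h' \<in> H \<Longrightarrow> [\<chi> l (h \<otimes> h') = \<chi> l h + \<chi> l h'] (mod int q)"
    and ker: "\<And>h. h \<in> H \<Longrightarrow> (\<And>l. l < r \<Longrightarrow> int q dvd \<chi> l h) \<Longrightarrow> h = \<one>"
    using H by (auto simp: coordinates_def)
  have HG: "h \<in> carrier G" if "h \<in> H" for h
    using subgroup.mem_carrier[OF subH that] .
  have q0: "q > 0" using q prime_gt_0_nat by blast
  define e where "e = (\<lambda>(h, m::nat). h \<otimes> x [^] m)"
  define D where "D = H \<times> {..<q}"
  have pow_notin: "x [^] m \<notin> H" if m: "0 < m" "m < q" for m
  proof
    assume xm: "x [^] m \<in> H"
    \<comment> \<open>As \<open>m\<close> is invertible modulo \<open>q\<close>, \<open>x\<close> is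
      a power of \<open>x [^] m\<close> and would lie in \<open>H\<close>.\<close>
    have "coprime m q" using m q
      by (meson coprime_commute nat_dvd_not_less prime_imp_coprime)
    then obtain c where c: "[m * c = 1] (mod q)" using cong_solve_coprime_nat[of m q] by auto
    have "x = x [^] (1 mod q)"
      using pow_mod_exponent[OF x(1) exponent[OF x(1)], of 1] x(1) by simp
    also have "\<dots> = x [^] (m * c)"
      using c pow_mod_exponent[OF x(1) exponent[OF x(1)], of "m * c"] by (simp add: cong_def)
    also have "\<dots> = (x [^] m) [^] c" using x(1) by (simp add: nat_pow_pow)
    finally show False using subgroup_nat_pow[OF subH xm] x(2) by metis
  qed
  \<comment> \<open>The exponents are ordered so that their difference is a natural number;
    injectivity of \<open>e\<close> then follows by symmetry.\<close>
  have inj_le: "m = m' \<and> h = h'"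
    if "h \<in> H" "h' \<in> H" "m \<le> m'" "m' < q" "h \<otimes> x [^] m = h' \<otimes> x [^] m'" for h h' m m'
  proof -
    have "h' \<otimes> x [^] (m' - m) \<otimes> x [^] m = h \<otimes> x [^] m"
      using that x HG by (simp add: m_assoc nat_pow_mult)
    then have eq: "h' \<otimes> x [^] (m' - m) = h"
      using that(1,2) x HG by (metis nat_pow_closed right_cancel m_closed)
    then have "x [^] (m' - m) = inv h' \<otimes> h"
      using that x HG by (metis inv_solve_left nat_pow_closed)
    then have "x [^] (m' - m) \<in> H"
      using that subH by (simp add: subgroup.m_closed subgroup.m_inv_closed)
    then have "m' - m = 0" using pow_notin[of "m' - m"] that by fastforce
    then show ?thesis using eq that HG by simp
  qed
  have "inj_on e D"
  proof (rule inj_onI)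
    fix a b assume "a \<in> D" "b \<in> D" "e a = e b"
    then show "a = b"
      using inj_le[of "fst a" "fst b" "snd a" "snd b"] inj_le[of "fst b" "fst a" "snd b" "snd a"]
      by (cases "snd a \<le> snd b") (auto simp: D_def e_def split: prod.splits)
  qed
  define d where "d = the_inv_into D e"
  have d_e: "d (e a) = a" if "a \<in> D" for a
    unfolding d_def using \<open>inj_on e D\<close> that by (simp add: the_inv_into_f_f)
  define \<chi>' where "\<chi>' l y = (if l < r then \<chi> l (fst (d y)) else int (snd (d y)))" for l y
  have mult: "e (h, m) \<otimes> e (h', m') = e (h \<otimes> h', (m + m') mod q)"
    if "h \<in> H" "h' \<in> H" for h h' m m'
  proof -
    have "e (h, m) \<otimes> e (h', m') = h \<otimes> h' \<otimes> x [^] (m + m')"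
      using that x HG by (simp add: e_def m_ac nat_pow_mult[symmetric])
    then show ?thesis
      using pow_mod_exponent[OF x(1) exponent[OF x(1)]] by (simp add: e_def)
  qed
  have mem: "(h \<otimes> h', (m + m') mod q) \<in> D" if "h \<in> H" "h' \<in> H" for h h' m m'
    using that subH q0 by (auto simp: D_def subgroup.m_closed)
  have "subgroup (e ` D) G"
  proof (rule subgroupI)
    show "e ` D \<subseteq> carrier G" using HG x by (auto simp: D_def e_def)
    show "e ` D \<noteq> {}" using subgroup.one_closed[OF subH] q0 by (auto simp: D_def)
  next
    fix a assume "a \<in> e ` D"
    then obtain h m where a: "a = e (h, m)" "h \<in> H" "m < q" by (auto simp: D_def)
    have inv_h: "inv h \<in> H" using a subH by (simp add: subgroup.m_inv_closed)
    \<comment> \<open>The exponent is reduced modulo \<open>q\<close> because for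
      \<open>m = 0\<close> the value \<open>q - m\<close> is \<open>q\<close>, outside the allowed
      range.\<close>
    have "e (inv h, (q - m) mod q) \<otimes> e (h, m) = e (inv h \<otimes> h, ((q - m) mod q + m) mod q)"
      using mult inv_h a by blast
    also have "\<dots> = \<one>" using a HG q0 by (simp add: e_def mod_add_left_eq)
    finally have "inv a = e (inv h, (q - m) mod q)"
      using a HG inv_h x by (intro inv_equality) (auto simp: e_def)
    then show "inv a \<in> e ` D" using inv_h q0 by (auto simp: D_def)
  next
    fix a b assume "a \<in> e ` D" "b \<in> e ` D"
    then show "a \<otimes> b \<in> e ` D" using mult mem by (force simp: D_def)
  qed
  moreover have "card (e ` D) = q ^ Suc r"
    using \<open>inj_on e D\<close> cardH by (simp add: card_image D_def card_cartesian_product)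
  moreover have "[\<chi>' l (a \<otimes> b) = \<chi>' l a + \<chi>' l b] (mod int q)"
    if l: "l < Suc r" and ab: "a \<in> e ` D" "b \<in> e ` D" for l a b
  proof -
    obtain h m h' m' where hm: "(h, m) \<in> D" "(h', m') \<in> D" "a = e (h, m)" "b = e (h', m')"
      using ab by auto
    then have "h \<in> H" "h' \<in> H" by (auto simp: D_def)
    then have "d (a \<otimes> b) = (h \<otimes> h', (m + m') mod q)"
      using hm mult mem d_e by simp
    then show ?thesis
      using hm d_e hom \<open>h \<in> H\<close> \<open>h' \<in> H\<close> by (auto simp: \<chi>'_def zmod_int cong_def)
  qed
  moreover have "a = \<one>" if a: "a \<in> e ` D" and dvd: "\<And>l. l < Suc r \<Longrightarrow> int q dvd \<chi>' l a" for a
  proof -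
    obtain h m where hm: "(h, m) \<in> D" "a = e (h, m)" using a by auto
    then have "d a = (h, m)" "h \<in> H" "m < q" using d_e by (auto simp: D_def)
    moreover have "int q dvd int m" using dvd[of r] \<open>d a = _\<close> by (simp add: \<chi>'_def)
    ultimately have "m = 0" by (auto dest: dvd_imp_le)
    moreover have "int q dvd \<chi> l h" if "l < r" for l
      using dvd[of l] that \<open>d a = _\<close> by (simp add: \<chi>'_def)
    ultimately show ?thesis using ker[OF \<open>h \<in> H\<close>] hm by (simp add: e_def)
  qed
  ultimately have "coordinates q (e ` D) (Suc r) \<chi>'" by (auto simp: coordinates_def)
  then show ?thesis by blast
qed

text \<open>The trivial subgroup has coordinates, and the rank is bounded since
  \<open>r < q ^ r\<close> and \<open>q ^ r\<close> is the order of a subgroup. At maximal rank the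
  extension lemma leaves no element outside \<open>H\<close>.\<close>

lemma (in comm_group) coordinates_exist:
  assumes q: "prime q" and exponent: "\<And>x. x \<in> carrier G \<Longrightarrow> x [^] q = \<one>"
    and fin: "finite (carrier G)"
  obtains r \<chi> where "coordinates q (carrier G) r \<chi>"
proof -
  define R where "R = {r. \<exists>H \<chi>. coordinates q H r \<chi>}"
  have "coordinates q {\<one>} 0 \<chi>" for \<chi>
    using triv_subgroup by (simp add: coordinates_def)
  then have "R \<noteq> {}" by (auto simp: R_def)
  have "r \<le> card (carrier G)" if "r \<in> R" for r
  proof -
    from that obtain H \<chi> where "coordinates q H r \<chi>" by (auto simp: R_def)
    then have "q ^ r \<le> card (carrier G)"
      using fin by (metis card_mono coordinates_def subgroup.subset)
    moreover have "r < q ^ r"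
      using prime_gt_1_nat[OF q] by (simp add: power_gt_expt)
    ultimately show ?thesis by linarith
  qed
  then have "finite R" by (meson finite_nat_set_iff_bounded_le)
  then have "Max R \<in> R" using \<open>R \<noteq> {}\<close> by (rule Max_in)
  moreover have "Suc (Max R) \<notin> R"
    using Max_ge[OF \<open>finite R\<close>, of "Suc (Max R)"] by linarith
  ultimately obtain H \<chi> where H: "coordinates q H (Max R) \<chi>"
    and max: "\<And>H \<chi>. \<not> coordinates q H (Suc (Max R)) \<chi>"
    by (auto simp: R_def)
  have "carrier G \<subseteq> H"
    using coordinates_extend[OF q exponent H] max by blast
  moreover have "H \<subseteq> carrier G" using H by (auto simp: coordinates_def dest: subgroup.subset)
  ultimately have "H = carrier G" by blast
  then show ?thesis using H that by simp
qed

section \<open>Absorbing terms of supernilpotent algebras\<close>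

lemma eval_term_closed:
  assumes "is_algebra \<sigma> A" "u \<in> nary_terms \<sigma> n" "xs \<in> nlists n (universe A)"
  shows "eval_term A xs u \<in> universe A"
  using assms(2)
proof induction
  case (Var i)
  then show ?case using assms(3) by (simp add: nlistsE_nth_in)
next
  case (App f us)
  then have "map (eval_term A xs) us \<in> nlists (arity \<sigma> f) (universe A)"
    by (auto intro!: nlistsI)
  then show ?case using assms(1) App(1) by (simp add: is_algebra_def)
qed

section \<open>Existence of the least congruence behind the commutator\<close>

lemma set_list_all2_Times:
  "list_all2 (\<lambda>x y. (x, y) \<in> U \<times> U) xs ys \<Longrightarrow> set xs \<subseteq> U \<and> set ys \<subseteq> U \<and> length xs = length ys"
  by (induction rule: list_all2_induct) auto

lemma set_mixed_args_subset:
  assumes "\<And>i. i < m \<Longrightarrow> set (a i) \<subseteq> U \<and> set (b i) \<subseteq> U"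
  shows "set (mixed_args m a b I) \<subseteq> U"
  using assms by (auto simp: mixed_args_def split: if_splits) blast+

lemma length_mixed_args:
  assumes "\<And>i. i < m \<Longrightarrow> length (b i) = length (a i)"
  shows "length (mixed_args m a b I) = (\<Sum>i<m. length (a i))"
proof -
  have "length (mixed_args m a b I) = (\<Sum>i<m. length (if i \<in> I then b i else a i))"
    by (simp add: mixed_args_def length_concat interv_sum_list_conv_sum_set_nat comp_def
        lessThan_atLeast0)
  also have "\<dots> = (\<Sum>i<m. length (a i))"
    using assms by (intro sum.cong) auto
  finally show ?thesis .
qed

text \<open>Makes the family of congruences that defines the commutator nonempty. The content is
  that each concatenation is a tuple of the right length, so that the term values lie in the
  universe.\<close>

lemma centralizes_total:
  assumes "is_algebra \<sigma> A"
  shows "centralizes \<sigma> A (replicate (Suc k) (universe A \<times> universe A))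
           (universe A \<times> universe A)"
  unfolding centralizes_def Let_def
proof (intro allI ballI impI)
  let ?m = "length (replicate (Suc k) (universe A \<times> universe A)) - 1"
  fix a b t
  assume "\<forall>i\<le>?m. list_all2 (\<lambda>x y. (x, y) \<in> replicate (Suc k) (universe A \<times> universe A) ! i) (a i) (b i)"
    and t: "t \<in> term_functions \<sigma> A (\<Sum>i\<le>?m. length (a i))"
  then have ab: "set (a i) \<subseteq> universe A \<and> set (b i) \<subseteq> universe A \<and> length (a i) = length (b i)"
    if "i \<le> k" for i
    using that set_list_all2_Times[of "universe A" "a i" "b i"]
    by (simp add: nth_replicate del: replicate_Suc)
  have args: "mixed_args k a b I @ c \<in> nlists (\<Sum>i\<le>k. length (a i)) (universe A)"
    if "c = a k \<or> c = b k" for I c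
  proof (rule nlistsI)
    have "set (mixed_args k a b I) \<subseteq> universe A"
      using ab by (intro set_mixed_args_subset) simp
    then show "set (mixed_args k a b I @ c) \<subseteq> universe A"
      using that ab[of k] by auto
    have "length (mixed_args k a b I) = (\<Sum>i<k. length (a i))"
      using ab by (intro length_mixed_args) simp
    then show "length (mixed_args k a b I @ c) = (\<Sum>i\<le>k. length (a i))"
      using that ab[of k] by (auto simp: lessThan_Suc_atMost[symmetric])
  qed
  show "(t (mixed_args ?m a b {..<?m} @ a ?m), t (mixed_args ?m a b {..<?m} @ b ?m))
      \<in> universe A \<times> universe A"
    using t args eval_term_closed[OF assms] by (auto simp: term_functions_def)
qed

lemma congruence_total: "is_algebra \<sigma> A \<Longrightarrow> congruence \<sigma> A (universe A \<times> universe A)"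
  by (auto simp: congruence_def is_algebra_def equiv_def refl_on_def sym_def trans_def)

lemma congruence_Inter:
  assumes "S \<noteq> {}" "\<And>\<beta>. \<beta> \<in> S \<Longrightarrow> congruence \<sigma> A \<beta>"
  shows "congruence \<sigma> A (\<Inter>S)"
  unfolding congruence_def
proof (intro conjI ballI impI)
  have "equiv (universe A) \<beta>" if "\<beta> \<in> S" for \<beta>
    using assms(2)[OF that] by (simp add: congruence_def)
  then have *: "\<beta> \<subseteq> universe A \<times> universe A" "refl_on (universe A) \<beta>" "sym \<beta>" "trans \<beta>"
    if "\<beta> \<in> S" for \<beta>
    using that by (auto simp: equiv_def)
  have "\<Inter>S \<subseteq> universe A \<times> universe A" using assms(1) *(1) by blast
  moreover have "refl_on (universe A) (\<Inter>S)" using *(2) by (auto simp: refl_on_def)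
  moreover have "sym (\<Inter>S)" using *(3) by (auto simp: sym_def)
  moreover have "trans (\<Inter>S)" using *(4) unfolding trans_def by blast
  ultimately show "equiv (universe A) (\<Inter>S)" by (simp add: equiv_def)
next
  fix f xs ys
  assume f: "f \<in> syms \<sigma>" "xs \<in> nlists (arity \<sigma> f) (universe A)" "ys \<in> nlists (arity \<sigma> f) (universe A)"
    and rel: "list_all2 (\<lambda>x y. (x, y) \<in> \<Inter>S) xs ys"
  show "(oper A f xs, oper A f ys) \<in> \<Inter>S"
  proof
    fix \<beta> assume "\<beta> \<in> S"
    then have "list_all2 (\<lambda>x y. (x, y) \<in> \<beta>) xs ys"
      using rel by (auto elim: list_all2_mono)
    then show "(oper A f xs, oper A f ys) \<in> \<beta>"
      using assms(2)[OF \<open>\<beta> \<in> S\<close>] f by (simp add: congruence_def)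
  qed
qed

lemma centralizes_Inter:
  assumes "\<And>\<beta>. \<beta> \<in> S \<Longrightarrow> centralizes \<sigma> A \<alpha>s \<beta>"
  shows "centralizes \<sigma> A \<alpha>s (\<Inter>S)"
  unfolding centralizes_def Let_def
proof (intro allI impI ballI InterI)
  fix a b t \<beta>
  let ?m = "length \<alpha>s - 1"
  assume rel: "\<forall>i\<le>?m. list_all2 (\<lambda>x y. (x, y) \<in> \<alpha>s ! i) (a i) (b i)"
    and t: "t \<in> term_functions \<sigma> A (\<Sum>i\<le>?m. length (a i))"
    and prem: "\<forall>I\<subset>{..<?m}. (t (mixed_args ?m a b I @ a ?m), t (mixed_args ?m a b I @ b ?m)) \<in> \<Inter>S"
    and \<beta>: "\<beta> \<in> S"
  note term_condition = assms[OF \<beta>, unfolded centralizes_def Let_def,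
      THEN spec, THEN spec, THEN mp, OF rel, THEN bspec, OF t, THEN mp]
  show "(t (mixed_args ?m a b {..<?m} @ a ?m), t (mixed_args ?m a b {..<?m} @ b ?m)) \<in> \<beta>"
    using prem \<beta> by (intro term_condition) auto
qed

text \<open>The commutator is defined by a \<open>LEAST\<close> operator, so the existence of a least element has
  to be established before anything can be concluded from supernilpotency.\<close>

lemma supernilpotent_centralizes:
  assumes "is_algebra \<sigma> A" "supernilpotent \<sigma> k A"
  shows "centralizes \<sigma> A (replicate (Suc k) (universe A \<times> universe A)) (Id_on (universe A))"
proof -
  let ?\<alpha>s = "replicate (Suc k) (universe A \<times> universe A)"
  define S where "S = {\<beta>. congruence \<sigma> A \<beta> \<and> centralizes \<sigma> A ?\<alpha>s \<beta>}"
  have "S \<noteq> {}"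
    using congruence_total centralizes_total assms(1) unfolding S_def by blast
  then have "congruence \<sigma> A (\<Inter>S)" by (rule congruence_Inter) (simp add: S_def)
  moreover have "centralizes \<sigma> A ?\<alpha>s (\<Inter>S)" by (rule centralizes_Inter) (simp add: S_def)
  ultimately have "commutator \<sigma> A ?\<alpha>s = \<Inter>S"
    unfolding commutator_def by (intro Least_equality) (auto simp: S_def)
  then show ?thesis
    using \<open>centralizes \<sigma> A ?\<alpha>s (\<Inter>S)\<close> assms(2) by (simp add: supernilpotent_def)
qed

section \<open>Renaming variables and locating entries in concatenated blocks\<close>

primrec rename_vars :: "(nat \<Rightarrow> nat) \<Rightarrow> 'f uterm \<Rightarrow> 'f uterm" where
  "rename_vars h (Var i) = Var (h i)"
| "rename_vars h (App f us) = App f (map (rename_vars h) us)"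

lemma rename_vars_nary_terms:
  assumes "u \<in> nary_terms \<sigma> n" "\<And>i. i < n \<Longrightarrow> h i < m"
  shows "rename_vars h u \<in> nary_terms \<sigma> m"
  using assms(1) by induction (auto intro!: nary_terms.intros assms(2))

lemma eval_rename_vars:
  assumes "u \<in> nary_terms \<sigma> n"
  shows "eval_term A xs (rename_vars h u) = eval_term A (map (\<lambda>i. xs ! h i) [0..<n]) u"
  using assms
proof induction
  case (App f us)
  have "map (eval_term A xs \<circ> rename_vars h) us = map (eval_term A (map (\<lambda>i. xs ! h i) [0..<n])) us"
    using App by simp
  then show ?case by (simp only: rename_vars.simps eval_term.simps map_map)
qed simp

lemma nth_concat_blocks:
  assumes "\<And>i. i < m \<Longrightarrow> length (f i) = l" "i < m" "j < l"
  shows "concat (map f [0..<m]) ! (i * l + j) = f i ! j"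
  using assms
proof (induction m)
  case (Suc m)
  have len: "length (concat (map f [0..<m])) = m * l"
    using Suc.prems(1)
    by (simp add: length_concat interv_sum_list_conv_sum_set_nat comp_def)
  show ?case
  proof (cases "i = m")
    case True
    then show ?thesis by (simp add: nth_append len)
  next
    case False
    then have "Suc i * l \<le> m * l" using Suc.prems(2) by (intro mult_right_mono) auto
    then have "i * l + j < m * l" using Suc.prems(3) by simp
    moreover have "concat (map f [0..<m]) ! (i * l + j) = f i ! j"
      using Suc False by simp
    ultimately show ?thesis by (simp add: nth_append len)
  qed
qed simp

text \<open>The blocks required by the term condition are \<open>k + 1\<close> full copies of \<open>xs\<close>, against
  \<open>k + 1\<close> copies of the constant tuple \<open>z\<close>; variable \<open>j\<close> of \<open>u\<close> is read from
  copy \<open>\<beta> j\<close>.\<close>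

lemma supernilpotent_absorbing:
  assumes A: "is_algebra \<sigma> A" "supernilpotent \<sigma> k A"
    and u: "u \<in> nary_terms \<sigma> n" and xs: "xs \<in> nlists n (universe A)" and z: "z \<in> universe A"
    and \<beta>: "\<And>j. j < n \<Longrightarrow> \<beta> j \<le> k"
    and absorbing: "\<And>I. I \<subset> {..k} \<Longrightarrow>
       eval_term A (map (\<lambda>j. if \<beta> j \<in> I then xs ! j else z) [0..<n]) u = z'"
  shows "eval_term A xs u = z'"
proof -
  define a b where "a = (\<lambda>i::nat. replicate n z)" and "b = (\<lambda>i::nat. xs)"
  \<comment> \<open>Position of entry \<open>j\<close> of block \<open>\<beta> j\<close> among
    consecutive blocks of length \<open>n\<close>.\<close>
  define h where "h j = \<beta> j * n + j" for j
  define t where "t = (\<lambda>ys\<in>nlists (Suc k * n) (universe A). eval_term A ys (rename_vars h u))"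
  have len: "length xs = n" and set: "set xs \<subseteq> universe A" using xs by simp_all
  have h: "h j < Suc k * n" if "j < n" for j
  proof -
    have "\<beta> j * n \<le> k * n" using \<beta>[OF that] by (rule mult_right_mono) simp
    then show ?thesis using that unfolding h_def mult_Suc by linarith
  qed
  have "t \<in> term_functions \<sigma> A (Suc k * n)"
    unfolding t_def term_functions_def mem_Collect_eq
    by (intro exI[of _ "rename_vars h u"] conjI refl rename_vars_nary_terms[OF u h])
  then have t: "t \<in> term_functions \<sigma> A (\<Sum>i\<le>k. length (a i))" by (simp add: a_def)
  have rel: "list_all2 (\<lambda>x y. (x, y) \<in> universe A \<times> universe A) (a i) (b i)" for i
    using len set z by (auto simp: a_def b_def list_all2_conv_all_nth)
  \<comment> \<open>The term condition treats its last block separately: \<open>J\<close> records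
    the choice for block \<open>k\<close> and \<open>I\<close> the choices for the earlier blocks.
    Together they form the subset of \<open>{..k}\<close> to which \<open>absorbing\<close>
    refers.\<close>
  have t_eval: "t (mixed_args k a b I @ (if k \<in> J then b k else a k))
      = eval_term A (map (\<lambda>j. if \<beta> j \<in> I \<inter> {..<k} \<union> J \<inter> {k} then xs ! j else z) [0..<n]) u" for I J
  proof -
    let ?I = "I \<inter> {..<k} \<union> J \<inter> {k}"
    let ?ys = "mixed_args k a b I @ (if k \<in> J then b k else a k)"
    have ys: "?ys = concat (map (\<lambda>i. if i \<in> ?I then b i else a i) [0..<Suc k])"
      by (auto simp: mixed_args_def intro!: arg_cong[of _ _ concat])
    have "length ?ys = Suc k * n"
      using length_mixed_args[of k b a I] len by (simp add: a_def b_def)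
    moreover have "set ?ys \<subseteq> universe A"
      using set z by (auto simp: mixed_args_def a_def b_def split: if_splits)
    ultimately have "?ys \<in> nlists (Suc k * n) (universe A)" by (rule nlistsI)
    then have "t ?ys = eval_term A (map (\<lambda>j. ?ys ! h j) [0..<n]) u"
      by (simp add: t_def eval_rename_vars[OF u])
    also have "map (\<lambda>j. ?ys ! h j) [0..<n] = map (\<lambda>j. if \<beta> j \<in> ?I then xs ! j else z) [0..<n]"
    proof (rule map_cong[OF refl])
      fix j assume "j \<in> set [0..<n]"
      then have j: "j < n" by simp
      have "?ys ! h j = (if \<beta> j \<in> ?I then b (\<beta> j) else a (\<beta> j)) ! j"
        unfolding ys h_def
        by (rule nth_concat_blocks) (use len \<beta>[OF j] j in \<open>auto simp: a_def b_def\<close>)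
      then show "?ys ! h j = (if \<beta> j \<in> ?I then xs ! j else z)"
        using j by (auto simp: a_def b_def)
    qed
    finally show ?thesis .
  qed
  have t_z: "t (mixed_args k a b I @ (if k \<in> J then b k else a k)) = z'"
    if "I \<inter> {..<k} \<union> J \<inter> {k} \<noteq> {..k}" for I J
    unfolding t_eval using that by (intro absorbing) auto
  \<comment> \<open>Membership in \<open>Id_on\<close> asks for more than equality. The empty set is
    a proper subset of \<open>{..k}\<close>, so \<open>z'\<close> is a value of the term
    \<open>u\<close>.\<close>
  have z': "z' \<in> universe A"
  proof -
    have "eval_term A (map (\<lambda>j. if \<beta> j \<in> {} then xs ! j else z) [0..<n]) u = z'"
      by (rule absorbing) auto
    moreover have "map (\<lambda>j. if \<beta> j \<in> {} then xs ! j else z) [0..<n] \<in> nlists n (universe A)"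
      using z by (auto intro!: nlistsI)
    ultimately show ?thesis using eval_term_closed[OF A(1) u] by blast
  qed
  \<comment> \<open>Every premise of the term condition compares \<open>z'\<close> with itself,
    since some block is still constantly \<open>z\<close>. The conclusion compares \<open>z'\<close>
    with the value at \<open>xs\<close>.\<close>
  have "(t (mixed_args k a b {..<k} @ a k), t (mixed_args k a b {..<k} @ b k)) \<in> Id_on (universe A)"
  proof -
    have "(t (mixed_args k a b I @ a k), t (mixed_args k a b I @ b k)) \<in> Id_on (universe A)"
      if "I \<subset> {..<k}" for I
    proof -
      have "I \<inter> {..<k} \<union> {} \<inter> {k} \<noteq> {..k}" "I \<inter> {..<k} \<union> {k} \<inter> {k} \<noteq> {..k}"
        using that by (auto simp: set_eq_iff)
      from this[THEN t_z] show ?thesis using z' by (simp add: Id_on_iff)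
    qed
    then show ?thesis
      using supernilpotent_centralizes[OF A] rel t unfolding centralizes_def Let_def
      by (simp add: nth_replicate del: replicate_Suc)
  qed
  moreover have "t (mixed_args k a b {..<k} @ a k) = z'"
    using t_z[of "{..<k}" "{}"] by (auto simp: set_eq_iff)
  moreover have "t (mixed_args k a b {..<k} @ b k) = eval_term A xs u"
  proof -
    have "map (\<lambda>j. if \<beta> j \<in> {..<k} \<inter> {..<k} \<union> {k} \<inter> {k} then xs ! j else z) [0..<n] = xs"
      using \<beta> len by (intro nth_equalityI) (auto simp: le_less)
    then show ?thesis using t_eval[of "{..<k}" "{k}"] by simp
  qed
  ultimately show ?thesis by auto
qed

section \<open>Iterated differences\<close>

definition restrict_tuple :: "'a \<Rightarrow> nat set \<Rightarrow> 'a list \<Rightarrow> 'a list" where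
  "restrict_tuple z I xs = map (\<lambda>j. if j \<in> I then xs ! j else z) [0..<length xs]"

lemma length_restrict_tuple [simp]: "length (restrict_tuple z I xs) = length xs"
  by (simp add: restrict_tuple_def)

lemma nth_restrict_tuple [simp]:
  "j < length xs \<Longrightarrow> restrict_tuple z I xs ! j = (if j \<in> I then xs ! j else z)"
  by (simp add: restrict_tuple_def)

lemma restrict_tuple_nlists:
  assumes "xs \<in> nlists n U" "z \<in> U"
  shows "restrict_tuple z I xs \<in> nlists n U"
  using assms nlistsE_nth_in[OF assms(1)]
  by (intro nlistsI) (auto simp: restrict_tuple_def)

lemma append_nlists: "xs \<in> nlists n U \<Longrightarrow> ys \<in> nlists m U \<Longrightarrow> xs @ ys \<in> nlists (n + m) U"
  by (intro nlistsI) simp_all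

text \<open>Zeroing is done on the term itself, so that iterated differences are again terms and the
  term condition applies to them.\<close>

primrec zero_var :: "nat \<Rightarrow> 'j group_sym uterm \<Rightarrow> 'j group_sym uterm" where
  "zero_var j (Var i) = (if i = j then App Zero [] else Var i)"
| "zero_var j (App f us) = App f (map (zero_var j) us)"

definition difference :: "nat \<Rightarrow> 'j group_sym uterm \<Rightarrow> 'j group_sym uterm" where
  "difference j u = App Plus [u, App Minus [zero_var j u]]"

lemma group_syms:
  "Plus \<in> syms (group_signature \<tau>)" "Minus \<in> syms (group_signature \<tau>)"
  "Zero \<in> syms (group_signature \<tau>)" "arity (group_signature \<tau>) Plus = 2"
  "arity (group_signature \<tau>) Minus = 1" "arity (group_signature \<tau>) Zero = 0"
  by (simp_all add: group_signature_def)

lemma zero_var_nary_terms: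
  assumes "u \<in> nary_terms (group_signature \<tau>) n"
  shows "zero_var j u \<in> nary_terms (group_signature \<tau>) n"
  using assms
proof induction
  case (Var i)
  then show ?case by (auto intro!: nary_terms.intros simp: group_syms)
next
  case (App f us)
  then show ?case by (auto intro!: nary_terms.App)
qed

lemma difference_nary_terms:
  assumes "u \<in> nary_terms (group_signature \<tau>) n"
  shows "difference j u \<in> nary_terms (group_signature \<tau>) n"
  unfolding difference_def
  using assms zero_var_nary_terms[OF assms]
  by (auto intro!: nary_terms.App simp: group_syms)

lemma foldr_difference_nary_terms:
  "u \<in> nary_terms (group_signature \<tau>) n \<Longrightarrow>
    foldr difference js u \<in> nary_terms (group_signature \<tau>) n"
  by (induction js) (simp_all add: difference_nary_terms)

lemma eval_zero_var:
  assumes "u \<in> nary_terms \<sigma> n" "length xs = n"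
  shows "eval_term A xs (zero_var j u) = eval_term A (xs[j := zero_elem A]) u"
  using assms(1)
proof induction
  case (Var i)
  then show ?case using assms(2) by (simp add: zero_elem_def)
next
  case (App f us)
  have "map (eval_term A xs \<circ> zero_var j) us = map (eval_term A (xs[j := zero_elem A])) us"
    using App by simp
  then show ?case by (simp only: zero_var.simps eval_term.simps map_map)
qed

section \<open>Iterated differences in a single expanded elementary abelian group\<close>

context
  fixes \<tau> :: "'j signature" and B :: "('j group_sym, 'b) algebra"
  assumes B: "expanded_elementary_abelian_group \<tau> B"
begin

lemma is_algebra_B: "is_algebra (group_signature \<tau>) B"
  using B by (simp add: expanded_elementary_abelian_group_def)

lemma comm_group_reduct: "comm_group (group_reduct B)"
  using B by (simp add: expanded_elementary_abelian_group_def elementary_abelian_group_def)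

interpretation comm_group "group_reduct B"
  rewrites "carrier (group_reduct B) = universe B" and "\<one>\<^bsub>group_reduct B\<^esub> = zero_elem B"
  by (auto simp: comm_group_reduct) (simp_all add: group_reduct_def)

lemma eval_closed:
  "u \<in> nary_terms (group_signature \<tau>) n \<Longrightarrow> xs \<in> nlists n (universe B) \<Longrightarrow>
    eval_term B xs u \<in> universe B"
  using eval_term_closed[OF is_algebra_B] .

lemma update_zero_nlists:
  "xs \<in> nlists n (universe B) \<Longrightarrow> xs[j := zero_elem B] \<in> nlists n (universe B)"
  by (intro nlistsI) (auto dest: set_update_subset_insert[THEN subsetD] nlistsE_set)

lemma eval_difference:
  assumes u: "u \<in> nary_terms (group_signature \<tau>) n" and xs: "xs \<in> nlists n (universe B)"
  shows "eval_term B xs (difference j u) = eval_term B xs u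
    \<otimes>\<^bsub>group_reduct B\<^esub> inv\<^bsub>group_reduct B\<^esub> eval_term B (xs[j := zero_elem B]) u"
proof -
  have "eval_term B (xs[j := zero_elem B]) u \<in> universe B"
    using eval_closed[OF u update_zero_nlists[OF xs]] .
  then have "oper B Minus [eval_term B (xs[j := zero_elem B]) u]
      = inv\<^bsub>group_reduct B\<^esub> eval_term B (xs[j := zero_elem B]) u"
    using B by (simp add: expanded_elementary_abelian_group_def)
  moreover have "x \<otimes>\<^bsub>group_reduct B\<^esub> y = oper B Plus [x, y]" for x y
    by (simp add: group_reduct_def)
  ultimately show ?thesis
    using eval_zero_var[OF u nlistsE_length[OF xs]] by (simp add: difference_def)
qed

text \<open>The difference for \<open>j\<close> itself subtracts equal values when entry
  \<open>j\<close> is zero. Differences for other variables combine values at tuples whose entry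
  \<open>j\<close> is still zero, and these vanish by induction.\<close>

lemma differences_absorbing:
  assumes u: "u \<in> nary_terms (group_signature \<tau>) n"
    and j: "j \<in> set js" "j < n"
    and xs: "xs \<in> nlists n (universe B)" "xs ! j = zero_elem B"
  shows "eval_term B xs (foldr difference js u) = zero_elem B"
  using j(1) xs
proof (induction js arbitrary: xs)
  case (Cons i js)
  have eq: "eval_term B xs (foldr difference (i # js) u) = eval_term B xs (foldr difference js u)
      \<otimes>\<^bsub>group_reduct B\<^esub> inv\<^bsub>group_reduct B\<^esub> eval_term B (xs[i := zero_elem B]) (foldr difference js u)"
    using eval_difference[OF foldr_difference_nary_terms[OF u]] Cons.prems by simp
  show ?case
  proof (cases "j = i")
    case True
    then have "xs[i := zero_elem B] = xs" using Cons.prems by (metis list_update_id)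
    then show ?thesis
      unfolding eq using eval_closed[OF foldr_difference_nary_terms[OF u]] Cons.prems by simp
  next
    case False
    then have "j \<in> set js" using Cons.prems by simp
    moreover have "xs[i := zero_elem B] ! j = zero_elem B" using False Cons.prems by simp
    ultimately show ?thesis
      unfolding eq using Cons.IH Cons.prems update_zero_nlists by simp
  qed
qed simp

lemma additive_diff:
  fixes \<chi> :: "'b \<Rightarrow> int"
  assumes \<chi>: "\<And>x y. x \<in> universe B \<Longrightarrow> y \<in> universe B \<Longrightarrow>
      [\<chi> (x \<otimes>\<^bsub>group_reduct B\<^esub> y) = \<chi> x + \<chi> y] (mod q)"
    and "x \<in> universe B" "y \<in> universe B"
  shows "[\<chi> (x \<otimes>\<^bsub>group_reduct B\<^esub> inv\<^bsub>group_reduct B\<^esub> y) = \<chi> x - \<chi> y] (mod q)"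
proof -
  have "x \<otimes>\<^bsub>group_reduct B\<^esub> inv\<^bsub>group_reduct B\<^esub> y \<otimes>\<^bsub>group_reduct B\<^esub> y = x"
    using assms(2,3) by (simp add: m_assoc)
  then have "[\<chi> x = \<chi> (x \<otimes>\<^bsub>group_reduct B\<^esub> inv\<^bsub>group_reduct B\<^esub> y) + \<chi> y] (mod q)"
    using \<chi>[of "x \<otimes>\<^bsub>group_reduct B\<^esub> inv\<^bsub>group_reduct B\<^esub> y" y] assms(2,3) by simp
  then show ?thesis by (simp add: cong_iff_dvd_diff dvd_diff_commute algebra_simps)
qed

text \<open>Expanding each difference means choosing whether its variable is kept or zeroed. The set
  \<open>K\<close> collects the zeroed ones, each contributing a factor -1.\<close>

lemma additive_differences:
  fixes \<chi> :: "'b \<Rightarrow> int"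
  assumes \<chi>: "\<And>x y. x \<in> universe B \<Longrightarrow> y \<in> universe B \<Longrightarrow>
      [\<chi> (x \<otimes>\<^bsub>group_reduct B\<^esub> y) = \<chi> x + \<chi> y] (mod q)"
    and u: "u \<in> nary_terms (group_signature \<tau>) n"
    and "distinct js" "xs \<in> nlists n (universe B)"
  shows "[\<chi> (eval_term B xs (foldr difference js u)) =
    (\<Sum>K\<in>Pow (set js). (-1) ^ card K * \<chi> (eval_term B (restrict_tuple (zero_elem B) (- K) xs) u))]
      (mod q)"
  using assms(3,4)
proof (induction js arbitrary: xs)
  case Nil
  have "restrict_tuple (zero_elem B) UNIV xs = xs" by (simp add: restrict_tuple_def map_nth)
  then show ?case by simp
next
  case (Cons i js)
  let ?v = "foldr difference js u" and ?xs' = "xs[i := zero_elem B]"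
  let ?f = "\<lambda>K. (-1) ^ card K * \<chi> (eval_term B (restrict_tuple (zero_elem B) (- K) xs) u)"
  have v: "?v \<in> nary_terms (group_signature \<tau>) n" by (rule foldr_difference_nary_terms[OF u])
  have xs': "?xs' \<in> nlists n (universe B)" by (rule update_zero_nlists[OF Cons.prems(2)])
  have restrict: "restrict_tuple (zero_elem B) (- K) ?xs'
      = restrict_tuple (zero_elem B) (- insert i K) xs" for K
    by (rule nth_equalityI) (auto simp: nth_list_update)
  have "[\<chi> (eval_term B xs (foldr difference (i # js) u))
      = \<chi> (eval_term B xs ?v) - \<chi> (eval_term B ?xs' ?v)] (mod q)"
    using additive_diff[OF \<chi>] eval_closed[OF v] Cons.prems xs'
    by (simp add: eval_difference[OF v])
  also have "[\<chi> (eval_term B xs ?v) - \<chi> (eval_term B ?xs' ?v)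
      = (\<Sum>K\<in>Pow (set js). ?f K) - (\<Sum>K\<in>Pow (set js).
          (-1) ^ card K * \<chi> (eval_term B (restrict_tuple (zero_elem B) (- K) ?xs') u))] (mod q)"
    using Cons.IH[OF _ Cons.prems(2)] Cons.IH[OF _ xs'] Cons.prems(1) by (intro cong_diff) simp_all
  also have "(\<Sum>K\<in>Pow (set js). ?f K) - (\<Sum>K\<in>Pow (set js).
          (-1) ^ card K * \<chi> (eval_term B (restrict_tuple (zero_elem B) (- K) ?xs') u))
      = (\<Sum>K\<in>Pow (set js). ?f K + ?f (insert i K))"
    unfolding sum_subtractf[symmetric] restrict
  proof (rule sum.cong[OF refl])
    fix K assume "K \<in> Pow (set js)"
    then have "finite K" "i \<notin> K" using Cons.prems(1) by (auto intro: finite_subset)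
    then show "?f K - (-1) ^ card K * \<chi> (eval_term B (restrict_tuple (zero_elem B) (- insert i K) xs) u)
        = ?f K + ?f (insert i K)" by simp
  qed
  also have "\<dots> = (\<Sum>K\<in>Pow (set (i # js)). ?f K)"
    using Cons.prems(1) by (simp add: sum_Pow_insert)
  finally show ?case .
qed

text \<open>By \<open>additive_differences\<close> this coefficient is the image under
  \<open>\<chi>\<close> of an iterated difference over \<open>J\<close>. That term is absorbing in
  more than \<open>k\<close> variables, so supernilpotency forces its value to be zero. The entries
  \<open>cs\<close> are reserved for the constants of polynomials.\<close>

lemma moebius_dvd:
  fixes \<chi> :: "'b \<Rightarrow> int"
  assumes nil: "supernilpotent (group_signature \<tau>) k B"
    and \<chi>: "\<And>x y. x \<in> universe B \<Longrightarrow> y \<in> universe B \<Longrightarrow>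
      [\<chi> (x \<otimes>\<^bsub>group_reduct B\<^esub> y) = \<chi> x + \<chi> y] (mod q)"
    and u: "u \<in> nary_terms (group_signature \<tau>) (n + m)"
    and xs: "xs \<in> nlists n (universe B)" and cs: "cs \<in> nlists m (universe B)"
    and J: "J \<subseteq> {..<n}" "k < card J"
  shows "q dvd moebius (\<lambda>I. \<chi> (eval_term B (restrict_tuple (zero_elem B) I xs @ cs) u)) J"
proof -
  define z where "z = zero_elem B"
  have z: "z \<in> universe B" using one_closed by (simp add: z_def)
  have finJ: "finite J" using J(1) finite_subset by blast
  define js where "js = sorted_list_of_set J"
  have js: "set js = J" "distinct js" using finJ by (simp_all add: js_def)
  \<comment> \<open>With the entries outside \<open>J\<close> zeroed beforehand, zeroing
    \<open>K\<close> retains exactly \<open>J - K\<close>, as in \<open>moebius\<close>.\<close>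
  define ys where "ys = restrict_tuple z J xs @ cs"
  have ys: "ys \<in> nlists (n + m) (universe B)"
    unfolding ys_def by (intro append_nlists restrict_tuple_nlists xs cs z)
  have len: "length xs = n" "length cs = m" using xs cs by simp_all
  obtain h where h: "bij_betw h J {0..<card J}" using ex_bij_betw_finite_nat[OF finJ] by blast
  \<comment> \<open>The first \<open>k + 1\<close> elements of \<open>J\<close> in the enumeration
    \<open>h\<close> get distinct blocks; all other variables, including those for
    \<open>cs\<close>, join block 0. As \<open>card J > k\<close>, no block lacks a variable from
    \<open>J\<close>.\<close>
  define \<beta> where "\<beta> j = (if j \<in> J \<and> h j \<le> k then h j else 0)" for j
  have "eval_term B ys (foldr difference js u) = z"
  proof (rule supernilpotent_absorbing[OF is_algebra_B nil foldr_difference_nary_terms[OF u] ys z])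
    show "\<beta> j \<le> k" for j by (simp add: \<beta>_def)
    fix I assume "I \<subset> {..k}"
    then obtain i where i: "i \<le> k" "i \<notin> I" by blast
    then have "i \<in> h ` J" using J(2) h by (simp add: bij_betw_def)
    then obtain j where j: "j \<in> J" "h j = i" by blast
    then have "\<beta> j \<notin> I" "j < n + m" using i J(1) by (auto simp: \<beta>_def)
    then show "eval_term B (map (\<lambda>j. if \<beta> j \<in> I then ys ! j else z) [0..<n + m])
        (foldr difference js u) = z"
      unfolding z_def using j(1) js(1) nlistsE_nth_in[OF ys] z
      by (intro differences_absorbing[OF u, of j]) (auto intro!: nlistsI simp: z_def)
  qed
  moreover have "[\<chi> z = 0] (mod q)"
    using additive_diff[OF \<chi> z z] z by (simp add: z_def)
  ultimately have "[0 = \<chi> (eval_term B ys (foldr difference js u))] (mod q)"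
    by (simp add: cong_sym)
  also have "[\<chi> (eval_term B ys (foldr difference js u)) =
      (\<Sum>K\<in>Pow J. (-1) ^ card K * \<chi> (eval_term B (restrict_tuple z (- K) ys) u))] (mod q)"
    using additive_differences[OF \<chi> u js(2) ys] js(1) by (simp add: z_def)
  also have "(\<Sum>K\<in>Pow J. (-1) ^ card K * \<chi> (eval_term B (restrict_tuple z (- K) ys) u))
      = moebius (\<lambda>I. \<chi> (eval_term B (restrict_tuple z I xs @ cs) u)) J"
    unfolding moebius_def
  proof (rule sum.cong[OF refl])
    fix K assume "K \<in> Pow J"
    then have "restrict_tuple z (- K) ys = restrict_tuple z (J - K) xs @ cs"
      using J(1) len by (intro nth_equalityI) (auto simp: ys_def nth_append)
    then show "(-1) ^ card K * \<chi> (eval_term B (restrict_tuple z (- K) ys) u) =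
        (-1) ^ card K * \<chi> (eval_term B (restrict_tuple z (J - K) xs @ cs) u)" by simp
  qed
  finally show ?thesis by (simp add: z_def cong_0_iff cong_sym_eq[of 0])
qed

text \<open>Each pair of a coordinate and a term gives a set function of degree at most
  \<open>k\<close> modulo the exponent prime. A small set that agrees with \<open>{..<n}\<close> on
  all these functions gives equal coordinates, hence equal values.\<close>

lemma supernilpotent_small_support:
  assumes nil: "supernilpotent (group_signature \<tau>) k B"
    and p: "prime p" "card (universe B) = p ^ \<alpha>"
    and us: "set us \<subseteq> nary_terms (group_signature \<tau>) (n + m)"
    and xs: "xs \<in> nlists n (universe B)" and cs: "cs \<in> nlists m (universe B)"
  obtains I where "I \<subseteq> {..<n}" "card I \<le> k * length us * \<alpha> * (p - 1)"
    "\<And>u. u \<in> set us \<Longrightarrow>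
      eval_term B (restrict_tuple (zero_elem B) I xs @ cs) u = eval_term B (xs @ cs) u"
proof -
  define z where "z = zero_elem B"
  have z: "z \<in> universe B" using one_closed by (simp add: z_def)
  obtain q :: nat where q: "prime q"
    and exponent: "\<And>x. x \<in> universe B \<Longrightarrow> x [^]\<^bsub>group_reduct B\<^esub> q = zero_elem B"
    using B by (auto simp: expanded_elementary_abelian_group_def elementary_abelian_group_def
        group_reduct_def)
  have fin: "finite (universe B)"
    using p by (metis card.infinite power_not_zero not_prime_0)
  obtain r \<chi> where "coordinates q (universe B) r \<chi>"
    using coordinates_exist[OF q exponent fin] by blast
  then have card: "card (universe B) = q ^ r"
    and \<chi>: "\<And>l x y. l < r \<Longrightarrow> x \<in> universe B \<Longrightarrow> y \<in> universe B \<Longrightarrow>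
      [\<chi> l (x \<otimes>\<^bsub>group_reduct B\<^esub> y) = \<chi> l x + \<chi> l y] (mod int q)"
    and ker: "\<And>x. x \<in> universe B \<Longrightarrow> (\<And>l. l < r \<Longrightarrow> int q dvd \<chi> l x) \<Longrightarrow> x = zero_elem B"
    by (auto simp: coordinates_def)
  \<comment> \<open>By uniqueness of prime powers the exponent prime \<open>q\<close> is
    \<open>p\<close> and \<open>r\<close> is \<open>\<alpha>\<close>, unless the group is trivial;
    then \<open>r\<close> and \<open>\<alpha>\<close> are both 0, whatever \<open>q\<close>
    is.\<close>
  have bound: "r * (q - 1) = \<alpha> * (p - 1)"
  proof (cases "\<alpha> = 0")
    case True
    then have "q ^ r = 1" using card p by simp
    then have "r = 0" using prime_gt_1_nat[OF q] by simp
    then show ?thesis using True by simp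
  next
    case False
    have "p ^ \<alpha> = q ^ r" using card p by simp
    moreover from this have "r \<noteq> 0" using False prime_gt_1_nat[OF p(1)] by (intro notI) simp
    ultimately show ?thesis
      using prime_power_inj'[OF p(1) q, of \<alpha> r] False by simp
  qed
  define f where "f = (\<lambda>(l, i) I. \<chi> l (eval_term B (restrict_tuple z I xs @ cs) (us ! i)))"
  define L where "L = {..<r} \<times> {..<length us}"
  have args: "restrict_tuple z I xs @ cs \<in> nlists (n + m) (universe B)" for I
    by (intro append_nlists restrict_tuple_nlists xs cs z)
  \<comment> \<open>The functions \<open>f l\<close> have bounded degree only modulo
    \<open>q\<close>, so \<open>small_solution\<close> is applied to polynomials congruent to them
    on the subsets of \<open>{..<n}\<close>.\<close>
  have "\<exists>g. degree_le k g \<and> (\<forall>I\<subseteq>{..<n}. [f l I = g I] (mod int q))" if lL: "l \<in> L" for l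
  proof -
    obtain l' i where l: "l = (l', i)" "l' < r" "i < length us" using lL by (auto simp: L_def)
    then have "us ! i \<in> nary_terms (group_signature \<tau>) (n + m)" using us by auto
    then have "int q dvd moebius (f l) J" if "J \<subseteq> {..<n}" "k < card J" for J
      using moebius_dvd[OF nil \<chi>[OF l(2)] _ xs cs that] by (simp add: f_def l(1) z_def)
    then show ?thesis
      using degree_le_of_moebius[of "{..<n}" k "int q" "f l"] by (metis finite_lessThan)
  qed
  then obtain g where g: "\<And>l. l \<in> L \<Longrightarrow> degree_le k (g l)"
    "\<And>l I. l \<in> L \<Longrightarrow> I \<subseteq> {..<n} \<Longrightarrow> [f l I = g l I] (mod int q)"
    by metis
  obtain I where I: "I \<subseteq> {..<n}" "card I \<le> k * (q - 1) * card L"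
    and sol: "\<And>l. l \<in> L \<Longrightarrow> [g l I = g l {..<n}] (mod int q)"
    using small_solution[OF q, of L "{..<n}" k g] g(1) by (auto simp: L_def)
  have "k * (q - 1) * card L = k * length us * (r * (q - 1))"
    by (simp add: L_def card_cartesian_product)
  then have "k * (q - 1) * card L = k * length us * \<alpha> * (p - 1)"
    unfolding bound by (simp only: mult.assoc)
  then have "card I \<le> k * length us * \<alpha> * (p - 1)" using I(2) by (simp only:)
  moreover have "eval_term B (restrict_tuple (zero_elem B) I xs @ cs) u = eval_term B (xs @ cs) u"
    if u: "u \<in> set us" for u
  proof -
    obtain i where i: "i < length us" "u = us ! i" using u by (metis in_set_conv_nth)
    let ?e = "\<lambda>I. eval_term B (restrict_tuple z I xs @ cs) u"
    have closed: "?e I \<in> universe B" for I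
      using eval_closed[OF _ args] u us by blast
    have "[\<chi> l (?e I) = \<chi> l (?e {..<n})] (mod int q)" if "l < r" for l
    proof -
      have L: "(l, i) \<in> L" using that i by (simp add: L_def)
      have "[f (l, i) I = f (l, i) {..<n}] (mod int q)"
        using g(2)[OF L I(1)] sol[OF L] g(2)[OF L order_refl] by (meson cong_sym cong_trans)
      then show ?thesis by (simp add: f_def i)
    qed
    then have "int q dvd \<chi> l (?e I \<otimes>\<^bsub>group_reduct B\<^esub> inv\<^bsub>group_reduct B\<^esub> ?e {..<n})" if "l < r" for l
      using additive_diff[OF \<chi>[OF that] closed closed] that
      by (metis cong_dvd_iff cong_iff_dvd_diff)
    then have "?e I \<otimes>\<^bsub>group_reduct B\<^esub> inv\<^bsub>group_reduct B\<^esub> ?e {..<n} = zero_elem B"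
      using closed by (intro ker) simp_all
    then have "?e I = ?e {..<n}" using closed by (metis inv_equality inv_inv inv_closed)
    moreover have "restrict_tuple z {..<n} xs = xs"
      using xs by (intro nth_equalityI) auto
    ultimately show ?thesis by (simp add: z_def)
  qed
  ultimately show ?thesis using I(1) that by blast
qed

end

section \<open>Polynomials of direct products\<close>

text \<open>Translates a term over the constants of the product into a term of one factor, in which
  \<open>h c\<close> is the variable that holds the relevant component of the constant \<open>c\<close>.\<close>

primrec abstract_consts :: "('c \<Rightarrow> nat) \<Rightarrow> ('f + 'c) uterm \<Rightarrow> 'f uterm" where
  "abstract_consts h (Var i) = Var i"
| "abstract_consts h (App f us) =
     (case f of Inl g \<Rightarrow> App g (map (abstract_consts h) us) | Inr c \<Rightarrow> Var (h c))"

lemma abstract_consts_nary_terms: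
  assumes "u \<in> nary_terms (const_signature \<sigma> A) n"
    and "\<And>c. c \<in> universe A \<Longrightarrow> h c < n + m"
  shows "abstract_consts h u \<in> nary_terms \<sigma> (n + m)"
  using assms(1)
proof induction
  case (Var i)
  then show ?case by (auto intro: nary_terms.Var)
next
  case (App f us)
  then show ?case
    by (cases f) (auto simp: const_signature_def intro!: nary_terms.intros assms(2))
qed

text \<open>Projection to factor \<open>i\<close> commutes with the operations, and constants are
  read from the list \<open>cs\<close> placed after the \<open>n\<close> proper variables; hence the
  shift by \<open>n\<close> in \<open>h\<close>.\<close>

lemma eval_abstract_consts:
  assumes "u \<in> nary_terms (const_signature \<sigma> (prod_algebra I B)) n"
    and "i \<in> I" "length xs = n"
    and h: "\<And>c. c \<in> universe (prod_algebra I B) \<Longrightarrow> h c \<ge> n \<and> cs ! (h c - n) = c i"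
  shows "eval_term (const_expansion (prod_algebra I B)) xs u i
    = eval_term (B i) (map (\<lambda>x. x i) xs @ cs) (abstract_consts h u)"
  using assms(1)
proof induction
  case (Var j)
  then show ?case using assms(3) by (simp add: nth_append)
next
  case (App f us)
  show ?case
  proof (cases f)
    case (Inl g)
    have "map ((\<lambda>x. x i) \<circ> eval_term (const_expansion (prod_algebra I B)) xs) us
        = map (eval_term (B i) (map (\<lambda>x. x i) xs @ cs) \<circ> abstract_consts h) us"
      using App.IH by simp
    moreover have "oper (const_expansion (prod_algebra I B)) (Inl g) zs i
        = oper (B i) g (map (\<lambda>x. x i) zs)" for zs
      using assms(2) by (simp add: const_expansion_def prod_algebra_def)
    ultimately show ?thesis
      by (simp only: Inl eval_term.simps abstract_consts.simps sum.case map_map)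
  next
    case (Inr c)
    then have "c \<in> universe (prod_algebra I B)"
      using App(1) by (auto simp: const_signature_def)
    then show ?thesis
      using h[of c] assms(3) by (simp add: Inr const_expansion_def nth_append)
  qed
qed

text \<open>Elements of the product are functions on a whole type, so agreement of the components in
  \<open>I\<close> yields equality only together with extensionality.\<close>

lemma eval_prod_algebra_extensional:
  assumes "u \<in> nary_terms (const_signature \<sigma> (prod_algebra I B)) n"
    and "xs \<in> nlists n (universe (prod_algebra I B))"
  shows "eval_term (const_expansion (prod_algebra I B)) xs u \<in> extensional I"
  using assms(1)
proof cases
  case (Var i)
  then have "xs ! i \<in> universe (prod_algebra I B)" using assms(2) nlistsE_nth_in by blast
  then show ?thesis using Var by (simp add: prod_algebra_def PiE_def)
next
  case (App f us)
  then show ?thesis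
    by (cases f) (auto simp: const_expansion_def const_signature_def prod_algebra_def PiE_def)
qed

lemma Pol_vec_terms:
  assumes "F \<in> Pol_vec \<sigma> A n s"
  obtains us where "length us = s" "set us \<subseteq> nary_terms (const_signature \<sigma> A) n"
    "\<And>xs. xs \<in> nlists n (universe A) \<Longrightarrow> F xs = map (eval_term (const_expansion A) xs) us"
proof -
  let ?ev = "\<lambda>u. \<lambda>xs\<in>nlists n (universe A). eval_term (const_expansion A) xs u"
  obtain fs where "fs \<in> nlists s (Pol \<sigma> A n)"
    and F: "F = (\<lambda>xs\<in>nlists n (universe A). map (\<lambda>f. f xs) fs)"
    using assms unfolding Pol_vec_def by blast
  then have fs: "length fs = s" "set fs \<subseteq> Pol \<sigma> A n" by simp_all
  have "\<forall>f\<in>set fs. \<exists>u. u \<in> nary_terms (const_signature \<sigma> A) n \<and> f = ?ev u"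
    using fs(2) by (auto simp: Pol_def term_functions_def const_expansion_def)
  then obtain g where g: "\<And>f. f \<in> set fs \<Longrightarrow> g f \<in> nary_terms (const_signature \<sigma> A) n"
    "\<And>f. f \<in> set fs \<Longrightarrow> f = ?ev (g f)"
    by metis
  show ?thesis
  proof
    show "length (map g fs) = s" using fs(1) by simp
    show "set (map g fs) \<subseteq> nary_terms (const_signature \<sigma> A) n" using g(1) by auto
    fix xs assume xs: "xs \<in> nlists n (universe A)"
    have "f xs = eval_term (const_expansion A) xs (g f)" if "f \<in> set fs" for f
      using fun_cong[OF g(2)[OF that], of xs] xs by simp
    then show "F xs = map (eval_term (const_expansion A) xs) (map g fs)"
      using xs by (simp add: F)
  qed
qed

section \<open>Assembling small supports in the factors into one tuple\<close>

theorem theorem4p3: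
  fixes n s t :: nat
    and k p \<alpha> :: "nat \<Rightarrow> nat"
    and \<tau> :: "'j signature"
    and B :: "nat \<Rightarrow> ('j group_sym, 'b) algebra"
    and A :: "('j group_sym, nat \<Rightarrow> 'b) algebra"
    and F :: "(nat \<Rightarrow> 'b) list \<Rightarrow> (nat \<Rightarrow> 'b) list"
    and a :: "(nat \<Rightarrow> 'b) list"
  assumes "\<And>i. i \<in> {1..t} \<Longrightarrow> k i \<ge> 1"
    and "\<And>i. i \<in> {1..t} \<Longrightarrow> expanded_elementary_abelian_group \<tau> (B i)"
    and "\<And>i. i \<in> {1..t} \<Longrightarrow> supernilpotent (group_signature \<tau>) (k i) (B i)"
    and "\<And>i. i \<in> {1..t} \<Longrightarrow> prime (p i)"
    and "\<And>i. i \<in> {1..t} \<Longrightarrow> card (universe (B i)) = p i ^ \<alpha> i"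
    and "A = prod_algebra {1..t} B"
    and "F \<in> Pol_vec (group_signature \<tau>) A n s"
    and "a \<in> nlists n (universe A)"
  shows "\<exists>y\<in>nlists n (universe A).
           weight A y \<le> (\<Sum>i=1..t. k i * s * \<alpha> i * (p i - 1)) \<and> F a = F y"
proof -
  note B = assms(2) and A = assms(6) and a = assms(8)
  obtain us where len_us: "length us = s"
    and us: "set us \<subseteq> nary_terms (const_signature (group_signature \<tau>) A) n"
    and F: "\<And>xs. xs \<in> nlists n (universe A) \<Longrightarrow> F xs = map (eval_term (const_expansion A) xs) us"
    using Pol_vec_terms[OF assms(7)] by blast
  have univ: "universe A = PiE {1..t} (\<lambda>i. universe (B i))"
    by (simp add: A prod_algebra_def)
  have len_a: "length a = n" using a by simp
  have a_mem: "(a ! j) i \<in> universe (B i)" if "j < n" "i \<in> {1..t}" for i j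
    using nlistsE_nth_in[OF a that(1)] that(2) unfolding univ by (rule PiE_mem)
  have zero: "zero_elem (B i) \<in> universe (B i)" if "i \<in> {1..t}" for i
    using is_algebra_B[OF B[OF that]] by (auto simp: is_algebra_def group_syms zero_elem_def)
  \<comment> \<open>The claim covers every \<open>xs\<close> with the prescribed projection to
    factor \<open>i\<close>, because the final tuple is built only after the sets of all factors are
    chosen.\<close>
  have "\<exists>I. I \<subseteq> {..<n} \<and> card I \<le> k i * s * \<alpha> i * (p i - 1) \<and>
      (\<forall>xs u. length xs = n \<longrightarrow> u \<in> set us \<longrightarrow>
        map (\<lambda>x. x i) xs = restrict_tuple (zero_elem (B i)) I (map (\<lambda>x. x i) a) \<longrightarrow>
        eval_term (const_expansion A) xs u i = eval_term (const_expansion A) a u i)"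
    if i: "i \<in> {1..t}" for i
  proof -
    have "finite (universe (B i))"
      using assms(4,5)[OF i] by (metis card.infinite power_not_zero not_prime_0)
    \<comment> \<open>A list of all elements of the finite factor supplies the constants;
      \<open>g c\<close> below is a position at which the component of \<open>c\<close>
      occurs.\<close>
    then obtain cs where cs: "set cs = universe (B i)" using finite_list by blast
    then have "\<forall>c\<in>universe A. \<exists>j. j < length cs \<and> cs ! j = c i"
      using i univ by (metis PiE_mem in_set_conv_nth)
    then obtain g where g: "\<And>c. c \<in> universe A \<Longrightarrow> g c < length cs"
      "\<And>c. c \<in> universe A \<Longrightarrow> cs ! g c = c i"
      by metis
    let ?us = "map (abstract_consts (\<lambda>c. n + g c)) us"
    have terms: "set ?us \<subseteq> nary_terms (group_signature \<tau>) (n + length cs)"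
      using us g(1) by (auto intro!: abstract_consts_nary_terms)
    have ai: "map (\<lambda>x. x i) a \<in> nlists n (universe (B i))"
      using a_mem i len_a by (intro nlistsI) (auto simp: in_set_conv_nth)
    have cs': "cs \<in> nlists (length cs) (universe (B i))"
      using cs by (intro nlistsI) simp_all
    obtain I where I: "I \<subseteq> {..<n}" "card I \<le> k i * length ?us * \<alpha> i * (p i - 1)"
      and sol: "\<And>u. u \<in> set ?us \<Longrightarrow>
        eval_term (B i) (restrict_tuple (zero_elem (B i)) I (map (\<lambda>x. x i) a) @ cs) u
          = eval_term (B i) (map (\<lambda>x. x i) a @ cs) u"
      by (rule supernilpotent_small_support[OF B[OF i] assms(3-5)[OF i] terms ai cs'])
        (rule that)
    have ev: "eval_term (const_expansion A) xs u i
        = eval_term (B i) (map (\<lambda>x. x i) xs @ cs) (abstract_consts (\<lambda>c. n + g c) u)"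
      if "length xs = n" "u \<in> set us" for xs u
      unfolding A
    proof (rule eval_abstract_consts[OF _ i that(1)])
      show "u \<in> nary_terms (const_signature (group_signature \<tau>) (prod_algebra {1..t} B)) n"
        using us that(2) A by blast
    qed (use g(2) A in simp)
    show ?thesis
    proof (intro exI[of _ I] conjI allI impI)
      show "card I \<le> k i * s * \<alpha> i * (p i - 1)" using I(2) len_us by simp
      fix xs u
      assume *: "length xs = n" "u \<in> set us"
        "map (\<lambda>x. x i) xs = restrict_tuple (zero_elem (B i)) I (map (\<lambda>x. x i) a)"
      show "eval_term (const_expansion A) xs u i = eval_term (const_expansion A) a u i"
        using sol *(2) unfolding ev[OF *(1,2)] ev[OF len_a *(2)] *(3) by simp
    qed (rule I(1))
  qed
  then obtain I where I: "\<And>i. i \<in> {1..t} \<Longrightarrow> I i \<subseteq> {..<n}"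
    "\<And>i. i \<in> {1..t} \<Longrightarrow> card (I i) \<le> k i * s * \<alpha> i * (p i - 1)"
    and sol: "\<And>i xs u. i \<in> {1..t} \<Longrightarrow> length xs = n \<Longrightarrow> u \<in> set us \<Longrightarrow>
        map (\<lambda>x. x i) xs = restrict_tuple (zero_elem (B i)) (I i) (map (\<lambda>x. x i) a) \<Longrightarrow>
        eval_term (const_expansion A) xs u i = eval_term (const_expansion A) a u i"
    by metis
  \<comment> \<open>Component \<open>i\<close> of each entry follows \<open>I i\<close>
    independently of the other components, so each projection of \<open>y\<close> is the restricted
    tuple that \<open>sol\<close> expects.\<close>
  define y where
    "y = map (\<lambda>j. \<lambda>i\<in>{1..t}. if j \<in> I i then (a ! j) i else zero_elem (B i)) [0..<n]"
  have y: "y \<in> nlists n (universe A)"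
  proof (rule nlistsI)
    show "set y \<subseteq> universe A"
      using a_mem zero unfolding y_def univ by (auto intro!: PiE_I)
  qed (simp add: y_def)
  \<comment> \<open>An entry of \<open>y\<close> can be nonzero only if its position lies in some
    \<open>I i\<close>.\<close>
  have "weight A y \<le> card (\<Union>i\<in>{1..t}. I i)"
    unfolding weight_def
  proof (rule card_mono)
    show "finite (\<Union>i\<in>{1..t}. I i)" using finite_subset[OF I(1)] by simp
    have "y ! j = zero_elem A" if "j < n" "\<And>i. i \<in> {1..t} \<Longrightarrow> j \<notin> I i" for j
      using that by (auto simp: y_def A zero_elem_def prod_algebra_def restrict_def fun_eq_iff)
    then show "{j. j < length y \<and> y ! j \<noteq> zero_elem A} \<subseteq> (\<Union>i\<in>{1..t}. I i)"
      using y by auto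
  qed
  also have "\<dots> \<le> (\<Sum>i=1..t. card (I i))" by (rule card_UN_le) simp
  also have "\<dots> \<le> (\<Sum>i=1..t. k i * s * \<alpha> i * (p i - 1))" by (intro sum_mono I(2))
  finally have weight: "weight A y \<le> (\<Sum>i=1..t. k i * s * \<alpha> i * (p i - 1))" .
  have "eval_term (const_expansion A) y u = eval_term (const_expansion A) a u" if u: "u \<in> set us" for u
  proof (rule extensionalityI[of _ "{1..t}"])
    have u': "u \<in> nary_terms (const_signature (group_signature \<tau>) (prod_algebra {1..t} B)) n"
      using u us A by blast
    show "eval_term (const_expansion A) y u \<in> extensional {1..t}"
      and "eval_term (const_expansion A) a u \<in> extensional {1..t}"
      using eval_prod_algebra_extensional[OF u'] y a unfolding A by blast+
    fix i assume i: "i \<in> {1..t}"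
    have "map (\<lambda>x. x i) y = restrict_tuple (zero_elem (B i)) (I i) (map (\<lambda>x. x i) a)"
      using len_a i by (intro nth_equalityI) (auto simp: y_def)
    then show "eval_term (const_expansion A) y u i = eval_term (const_expansion A) a u i"
      using sol[OF i _ u] y by simp
  qed
  then have "F a = F y" using F[OF a] F[OF y] by simp
  then show ?thesis using weight y by blast
qed

end
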